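(* Let $Q=Q(a,b,c,d)$ be a non-degenerate quadrilateral linkage with planar moduli space $M(Q)$ and let $R:M(Q)\to\mathbb{P}^1(\mathbb{C})$ be its uniformizer map. Then: (1) the image $\mathrm{Im}\,R$ is a subset of the circle $S=\{z\in\mathbb{C}:|z|=\frac{ac}{bd}\}$; (2) the image $\mathrm{Im}\,R$ is connected, symmetric about the real axis, and contains the point $-\frac{ac}{bd}$; (3) $R:M(Q)\to S$ is surjective if and only if $(a+b-c-d)(a-b+c-d)(a-b-c+d)\le 0$; (4) the mapping degree of $R:M(Q)\to S$ equals zero, and the multiplicity at each point does not exceed two, i.e. every point of $S$ has at most two preimages under $R$.
   Context: A quadrilateral linkage $Q=Q(a,b,c,d)$ is given by positive reals $a,b,c,d$ such that the largest does not exceed the sum of the other three. A planar configuration of $Q$ is a quadruple $V=(v_1,v_2,v_3,v_4)\in\mathbb{C}^4$ with $|v_2-v_1|=a$, $|v_3-v_2|=b$, $|v_4-v_3|=c$, $|v_1-v_4|=d$. The planar moduli space $M(Q)$ is the set of configurations modulo orientation-preserving isometries of $\mathbb{C}=\mathbb{R}^2$. $Q$ is non-degenerate if $a\pm b\pm c\pm d\neq 0$ for all choices of signs (equivalently, there are no configurations with all vertices on one line); then $M(Q)$ is a smooth compact 1-manifold, diffeomorphic to a circle or a disjoint union of two circles. The uniformizer is $$R(V)=\frac{v_2-v_1}{v_2-v_3}:\frac{v_4-v_1}{v_4-v_3}=\frac{(v_2-v_1)(v_4-v_3)}{(v_2-v_3)(v_4-v_1)}.$$ Orientation convention for the degree: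 with $\alpha=\arg\frac{v_3-v_2}{v_1-v_2}$ and $\gamma=\arg\frac{v_1-v_4}{v_3-v_4}$, $M(Q)$ is identified with the regular level set $\{a^2+b^2-2ab\cos\alpha-c^2-d^2+2cd\cos\gamma=0\}$ in the oriented torus of pairs $(\alpha,\gamma)$ and is oriented as such a level set. *)

theory Defs
  imports "HOL-Analysis.Analysis"
begin

section \<open>Quadrilateral linkages and their planar moduli spaces\<close>

definition quadrilateral_linkage :: "real \<Rightarrow> real \<Rightarrow> real \<Rightarrow> real \<Rightarrow> bool" where
  "quadrilateral_linkage a b c d \<longleftrightarrow>
     a > 0 \<and> b > 0 \<and> c > 0 \<and> d > 0 \<and>
     a \<le> b + c + d \<and> b \<le> a + c + d \<and> c \<le> a + b + d \<and> d \<le> a + b + c"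

definition nondegenerate_linkage :: "real \<Rightarrow> real \<Rightarrow> real \<Rightarrow> real \<Rightarrow> bool" where
  "nondegenerate_linkage a b c d \<longleftrightarrow>
     (\<forall>s\<in>{-1, 1}. \<forall>t\<in>{-1, 1}. \<forall>u\<in>{-1, 1}. a + s * b + t * c + u * d \<noteq> 0)"

type_synonym quad = "complex \<times> complex \<times> complex \<times> complex"

definition configurations :: "real \<Rightarrow> real \<Rightarrow> real \<Rightarrow> real \<Rightarrow> quad set" where
  "configurations a b c d =
     {(v1, v2, v3, v4). norm (v2 - v1) = a \<and> norm (v3 - v2) = b \<and>
                        norm (v4 - v3) = c \<and> norm (v1 - v4) = d}"

definition orientation_preserving_isometry :: "(complex \<Rightarrow> complex) \<Rightarrow> bool" where
  "orientation_preserving_isometry f \<longleftrightarrow> (\<exists>u w. norm u = 1 \<and> f = (\<lambda>z. u * z + w))"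

definition map_quad :: "(complex \<Rightarrow> complex) \<Rightarrow> quad \<Rightarrow> quad" where
  "map_quad f = (\<lambda>(v1, v2, v3, v4). (f v1, f v2, f v3, f v4))"

definition congruence :: "real \<Rightarrow> real \<Rightarrow> real \<Rightarrow> real \<Rightarrow> (quad \<times> quad) set" where
  "congruence a b c d =
     {(V, W). V \<in> configurations a b c d \<and> W \<in> configurations a b c d \<and>
              (\<exists>f. orientation_preserving_isometry f \<and> W = map_quad f V)}"

definition moduli_space :: "real \<Rightarrow> real \<Rightarrow> real \<Rightarrow> real \<Rightarrow> quad set set" where
  "moduli_space a b c d = configurations a b c d // congruence a b c d"


section \<open>The uniformizer\<close>

text \<open>As all side lengths are positive, none of the four differences below vanishes
  on a configuration (lemma \<open>configuration_sides_nonzero\<close>), so the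
  uniformizer never takes the value \<open>\<infinity>\<close> of the projective line and is
  treated as a complex-valued map.\<close>

definition quad_uniformizer :: "quad \<Rightarrow> complex" where
  "quad_uniformizer = (\<lambda>(v1, v2, v3, v4). ((v2 - v1) / (v2 - v3)) / ((v4 - v1) / (v4 - v3)))"

text \<open>The induced map on congruence classes; well defined by lemma
  \<open>uniformizer_class\<close>.\<close>

definition uniformizer :: "quad set \<Rightarrow> complex" where
  "uniformizer m = the_elem (quad_uniformizer ` m)"


section \<open>The moduli space as an oriented level set in the torus\<close>

text \<open>The torus of pairs of angles \<open>(\<alpha>, \<gamma>)\<close> modulo \<open>2\<pi>\<close> is realised as the set of
  pairs of unit complex numbers \<open>(cis \<alpha>, cis \<gamma>)\<close>.\<close>

definition level_function :: "real \<Rightarrow> real \<Rightarrow> real \<Rightarrow> real \<Rightarrow> real \<Rightarrow> real \<Rightarrow> real" where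
  "level_function a b c d \<alpha> \<gamma> =
     a\<^sup>2 + b\<^sup>2 - 2 * a * b * cos \<alpha> - c\<^sup>2 - d\<^sup>2 + 2 * c * d * cos \<gamma>"

definition level_set :: "real \<Rightarrow> real \<Rightarrow> real \<Rightarrow> real \<Rightarrow> (complex \<times> complex) set" where
  "level_set a b c d = {(cis \<alpha>, cis \<gamma>) | \<alpha> \<gamma>. level_function a b c d \<alpha> \<gamma> = 0}"

text \<open>With \<open>F\<close> the level function, the positive tangent direction at a point of the level
  set is \<open>(- \<partial>F/\<partial>\<gamma>, \<partial>F/\<partial>\<alpha>)\<close> in the coordinates \<open>(\<alpha>, \<gamma>)\<close>, so that the gradient of \<open>F\<close>
  followed by this vector is a positively oriented basis. A coordinate vector \<open>(s, t)\<close>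
  at \<open>(u, w)\<close> corresponds to the vector \<open>(s \<i> u, t \<i> w)\<close> in the ambient space.\<close>

definition level_tangent ::
  "real \<Rightarrow> real \<Rightarrow> real \<Rightarrow> real \<Rightarrow> complex \<times> complex \<Rightarrow> complex \<times> complex" where
  "level_tangent a b c d = (\<lambda>(u, w).
     (- deriv (\<lambda>t. level_function a b c d (Arg u) t) (Arg w) *\<^sub>R (\<i> * u),
      deriv (\<lambda>t. level_function a b c d t (Arg w)) (Arg u) *\<^sub>R (\<i> * w)))"

definition quad_angles :: "quad \<Rightarrow> complex \<times> complex" where
  "quad_angles = (\<lambda>(v1, v2, v3, v4).
     (cis (Arg ((v3 - v2) / (v1 - v2))), cis (Arg ((v1 - v4) / (v3 - v4)))))"

text \<open>The identification of the moduli space with the level set; it is a bijection for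
  non-degenerate linkages (lemma \<open>bij_betw_moduli_angles\<close>).\<close>

definition moduli_angles :: "quad set \<Rightarrow> complex \<times> complex" where
  "moduli_angles m = the_elem (quad_angles ` m)"


section \<open>Mapping degree of a map into a circle\<close>

text \<open>\<open>M\<close> is a closed 1-dimensional submanifold of a normed space, oriented by a
  nowhere vanishing tangent vector field \<open>\<tau>\<close>, and \<open>f\<close> maps \<open>M\<close> to the circle of radius
  \<open>r\<close> about the origin, oriented counterclockwise. If \<open>D\<close> is the derivative of \<open>f\<close> at \<open>x\<close>
  then \<open>Im (D (\<tau> x) / f x)\<close> is the derivative of the argument of \<open>f\<close> in direction \<open>\<tau> x\<close>.
  The vector \<open>\<tau> x\<close> being tangent to \<open>M\<close>, the value \<open>D (\<tau> x)\<close> does not depend on the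
  choice of the derivative \<open>D\<close> within \<open>M\<close>.\<close>

definition angular_derivative ::
  "'a::real_normed_vector set \<Rightarrow> ('a \<Rightarrow> 'a) \<Rightarrow> ('a \<Rightarrow> complex) \<Rightarrow> 'a \<Rightarrow> real" where
  "angular_derivative M \<tau> f x = Im (frechet_derivative f (at x within M) (\<tau> x) / f x)"

definition regular_value ::
  "'a::real_normed_vector set \<Rightarrow> ('a \<Rightarrow> 'a) \<Rightarrow> ('a \<Rightarrow> complex) \<Rightarrow> complex \<Rightarrow> bool" where
  "regular_value M \<tau> f y \<longleftrightarrow> (\<forall>x\<in>M. f x = y \<longrightarrow> angular_derivative M \<tau> f x \<noteq> 0)"

text \<open>A continuously differentiable \<open>f\<close> has degree \<open>k\<close> if the preimages of every regular
  value, counted with signs, sum up to \<open>k\<close>. The existence of regular values (Sard's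
  theorem) and the finiteness of their fibres are part of the definition.\<close>

definition has_mapping_degree ::
  "'a::real_normed_vector set \<Rightarrow> ('a \<Rightarrow> 'a) \<Rightarrow> ('a \<Rightarrow> complex) \<Rightarrow> real \<Rightarrow> int \<Rightarrow> bool" where
  "has_mapping_degree M \<tau> f r k \<longleftrightarrow>
     f ` M \<subseteq> sphere 0 r \<and>
     f differentiable_on M \<and> continuous_on M (angular_derivative M \<tau> f) \<and>
     (\<exists>y\<in>sphere 0 r. regular_value M \<tau> f y) \<and>
     (\<forall>y\<in>sphere 0 r. regular_value M \<tau> f y \<longrightarrow>
        finite {x\<in>M. f x = y} \<and>
        (\<Sum>x | x \<in> M \<and> f x = y. sgn (angular_derivative M \<tau> f x)) = of_int k)"

definition uniformizer_degree :: "real \<Rightarrow> real \<Rightarrow> real \<Rightarrow> real \<Rightarrow> int \<Rightarrow> bool" where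
  "uniformizer_degree a b c d k \<longleftrightarrow>
     has_mapping_degree (level_set a b c d) (level_tangent a b c d)
       (uniformizer \<circ> the_inv_into (moduli_space a b c d) moduli_angles)
       (a * c / (b * d)) k"


section \<open>Well-definedness\<close>

lemma configuration_sides_nonzero:
  assumes "quadrilateral_linkage a b c d" "(v1, v2, v3, v4) \<in> configurations a b c d"
  shows "v2 \<noteq> v1" "v2 \<noteq> v3" "v4 \<noteq> v3" "v4 \<noteq> v1"
  using assms by (auto simp: quadrilateral_linkage_def configurations_def)

lemma equiv_congruence: "equiv (configurations a b c d) (congruence a b c d)"
proof (rule equivI)
  show "congruence a b c d \<subseteq> configurations a b c d \<times> configurations a b c d"
    by (auto simp: congruence_def)
  have "V = map_quad (\<lambda>z. 1 * z + 0) V" for V by (cases V) (simp add: map_quad_def)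
  moreover have "orientation_preserving_isometry (\<lambda>z. 1 * z + 0)"
    unfolding orientation_preserving_isometry_def using norm_one by blast
  ultimately show "refl_on (configurations a b c d) (congruence a b c d)"
    unfolding refl_on_def congruence_def by blast
  show "sym (congruence a b c d)"
  proof (rule symI)
    fix V W assume "(V, W) \<in> congruence a b c d"
    then obtain u w where *: "V \<in> configurations a b c d" "W \<in> configurations a b c d"
      "norm u = 1" "W = map_quad (\<lambda>z. u * z + w) V"
      by (auto simp: congruence_def orientation_preserving_isometry_def)
    have u: "u \<noteq> 0" using *(3) by auto
    have "V = map_quad (\<lambda>z. inverse u * z + (- (inverse u * w))) W"
      using u unfolding *(4) by (cases V) (simp add: map_quad_def distrib_left mult.assoc[symmetric])
    moreover have "norm (inverse u) = 1" using *(3) by (simp add: norm_inverse)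
    ultimately show "(W, V) \<in> congruence a b c d"
      using * unfolding congruence_def orientation_preserving_isometry_def by blast
  qed
  show "trans (congruence a b c d)"
  proof (rule transI)
    fix V W X assume A: "(V, W) \<in> congruence a b c d" "(W, X) \<in> congruence a b c d"
    obtain u w where *: "V \<in> configurations a b c d"
      "norm u = 1" "W = map_quad (\<lambda>z. u * z + w) V"
      using A(1) by (auto simp: congruence_def orientation_preserving_isometry_def)
    obtain u' w' where **: "X \<in> configurations a b c d"
      "norm u' = 1" "X = map_quad (\<lambda>z. u' * z + w') W"
      using A(2) by (auto simp: congruence_def orientation_preserving_isometry_def)
    have "X = map_quad (\<lambda>z. (u' * u) * z + (u' * w + w')) V"
      unfolding *(3) **(3) by (cases V) (simp add: map_quad_def algebra_simps)
    moreover have "norm (u' * u) = 1" using * ** by (simp add: norm_mult)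
    ultimately show "(V, X) \<in> congruence a b c d"
      using * ** unfolding congruence_def orientation_preserving_isometry_def by blast
  qed
qed

lemma congruence_invariants:
  assumes "(V, W) \<in> congruence a b c d"
  shows "quad_uniformizer W = quad_uniformizer V" "quad_angles W = quad_angles V"
proof -
  obtain u w where u: "norm u = 1" and W: "W = map_quad (\<lambda>z. u * z + w) V"
    using assms by (auto simp: congruence_def orientation_preserving_isometry_def)
  have "u \<noteq> 0" using u by auto
  obtain v1 v2 v3 v4 where V: "V = (v1, v2, v3, v4)" by (metis prod.exhaust)
  have eq: "(u * x + w) - (u * y + w) = u * (x - y)" for x y by (simp add: algebra_simps)
  have quot: "(u * x) / (u * y) = x / y" for x y using \<open>u \<noteq> 0\<close> by simp
  show "quad_uniformizer W = quad_uniformizer V" "quad_angles W = quad_angles V"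
    unfolding W V map_quad_def quad_uniformizer_def quad_angles_def prod.case eq quot
    by (rule refl)+
qed

lemma uniformizer_class:
  assumes "V \<in> configurations a b c d"
  shows "uniformizer (congruence a b c d `` {V}) = quad_uniformizer V"
proof -
  have "V \<in> congruence a b c d `` {V}" using equiv_class_self[OF equiv_congruence assms] .
  moreover have "quad_uniformizer W = quad_uniformizer V" if "W \<in> congruence a b c d `` {V}" for W
    using that by (intro congruence_invariants(1)) (simp only: Image_singleton_iff)
  ultimately show ?thesis
    unfolding uniformizer_def by (intro the_elem_image_unique) blast+
qed

lemma moduli_angles_class:
  assumes "V \<in> configurations a b c d"
  shows "moduli_angles (congruence a b c d `` {V}) = quad_angles V"
proof -
  have "V \<in> congruence a b c d `` {V}" using equiv_class_self[OF equiv_congruence assms] .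
  moreover have "quad_angles W = quad_angles V" if "W \<in> congruence a b c d `` {V}" for W
    using that by (intro congruence_invariants(2)) (simp only: Image_singleton_iff)
  ultimately show ?thesis
    unfolding moduli_angles_def by (intro the_elem_image_unique) blast+
qed

lemma quad_angles_relations:
  assumes "quadrilateral_linkage a b c d" "(v1, v2, v3, v4) \<in> configurations a b c d"
    and "quad_angles (v1, v2, v3, v4) = (p, q)"
  shows "v3 - v2 = of_real (b / a) * p * (v1 - v2)" "v1 - v4 = of_real (d / c) * q * (v3 - v4)"
proof -
  have pos: "a > 0" "b > 0" "c > 0" "d > 0"
    using assms(1) by (auto simp: quadrilateral_linkage_def)
  have n: "norm (v1 - v2) = a" "norm (v3 - v2) = b" "norm (v3 - v4) = c" "norm (v1 - v4) = d"
    using assms(2) by (auto simp: configurations_def norm_minus_commute)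
  then have nz: "v1 - v2 \<noteq> 0" "v3 - v2 \<noteq> 0" "v3 - v4 \<noteq> 0" "v1 - v4 \<noteq> 0"
    using pos by auto
  have polar: "x = of_real (norm x / norm y) * cis (Arg (x / y)) * y"
    if "x \<noteq> 0" "y \<noteq> 0" for x y :: complex
  proof -
    have "x / y = of_real (norm (x / y)) * cis (Arg (x / y))"
      using rcis_cmod_Arg[of "x / y"] by (simp only: rcis_def)
    then show ?thesis using that by (simp add: norm_divide field_simps)
  qed
  have pq: "p = cis (Arg ((v3 - v2) / (v1 - v2)))" "q = cis (Arg ((v1 - v4) / (v3 - v4)))"
    using assms(3) by (auto simp: quad_angles_def)
  show "v3 - v2 = of_real (b / a) * p * (v1 - v2)"
    using polar[OF nz(2,1)] unfolding n pq .
  show "v1 - v4 = of_real (d / c) * q * (v3 - v4)"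
    using polar[OF nz(4,3)] unfolding n pq .
qed

lemma diagonal_nonzero:
  assumes "quadrilateral_linkage a b c d" "nondegenerate_linkage a b c d"
    and "(v1, v2, v3, v4) \<in> configurations a b c d"
  shows "v1 \<noteq> v3"
proof
  assume "v1 = v3"
  then have "a = b" "c = d"
    using assms(3) by (auto simp: configurations_def norm_minus_commute)
  then have "a + (-1) * b + 1 * c + (-1) * d = 0" by simp
  then show False using assms(2) unfolding nondegenerate_linkage_def by blast
qed

lemma norm_diff_cis:
  "(norm (of_real x - of_real y * cis t))\<^sup>2 = x\<^sup>2 + y\<^sup>2 - 2 * x * y * cos t"
proof -
  have "(norm (of_real x - of_real y * cis t))\<^sup>2 = (x - y * cos t)\<^sup>2 + (y * sin t)\<^sup>2"
    by (simp add: cmod_power2)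
  also have "\<dots> = x\<^sup>2 + y\<^sup>2 * ((sin t)\<^sup>2 + (cos t)\<^sup>2) - 2 * x * y * cos t"
    by (simp only: power2_eq_square algebra_simps)
  finally show ?thesis by (simp add: sin_cos_squared_add)
qed

lemma bij_betw_moduli_angles:
  assumes Q: "quadrilateral_linkage a b c d" and N: "nondegenerate_linkage a b c d"
  shows "bij_betw moduli_angles (moduli_space a b c d) (level_set a b c d)"
proof -
  have pos: "a > 0" "b > 0" "c > 0" "d > 0"
    using Q by (auto simp: quadrilateral_linkage_def)
  have congr: "(V, W) \<in> congruence a b c d"
    if V: "V \<in> configurations a b c d" and W: "W \<in> configurations a b c d"
      and eq: "quad_angles V = quad_angles W" for V W
  proof -
    obtain v1 v2 v3 v4 where v: "V = (v1, v2, v3, v4)" by (metis prod.exhaust)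
    obtain w1 w2 w3 w4 where w: "W = (w1, w2, w3, w4)" by (metis prod.exhaust)
    obtain p q where pq: "quad_angles V = (p, q)" by fastforce
    note rv = quad_angles_relations[OF Q V[unfolded v] pq[unfolded v]]
    note rw = quad_angles_relations[OF Q W[unfolded w] pq[unfolded eq w]]
    have nv: "norm (v1 - v2) = a" "norm (w1 - w2) = a"
      using V W by (auto simp: v w configurations_def norm_minus_commute)
    define u where "u = (w1 - w2) / (v1 - v2)"
    have u1: "norm u = 1" using nv pos by (simp add: u_def norm_divide)
    have v12: "v1 - v2 \<noteq> 0" using nv pos by auto
    have a1: "w1 - w2 = u * (v1 - v2)" using v12 by (simp add: u_def)
    have a2: "w3 - w2 = u * (v3 - v2)" using rv(1) rw(1) a1 by (simp add: algebra_simps)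
    have a3: "w1 - w3 = u * (v1 - v3)" using a1 a2 by algebra
    define k where "k = of_real (d / c) * q - 1"
    have kv: "v1 - v3 = k * (v3 - v4)" using rv(2) by (simp add: k_def algebra_simps)
    have kw: "w1 - w3 = k * (w3 - w4)" using rw(2) by (simp add: k_def algebra_simps)
    have "k \<noteq> 0" using kv diagonal_nonzero[OF Q N V[unfolded v]] by auto
    have "k * (w3 - w4) = k * (u * (v3 - v4))" using kv kw a3 by algebra
    then have a4: "w3 - w4 = u * (v3 - v4)" using \<open>k \<noteq> 0\<close> by simp
    have "w1 = u * v1 + (w2 - u * v2)" using a1 by algebra
    moreover have "w2 = u * v2 + (w2 - u * v2)" by algebra
    moreover have "w3 = u * v3 + (w2 - u * v2)" using a2 by algebra
    moreover have "w4 = u * v4 + (w2 - u * v2)" using a2 a4 by algebra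
    ultimately have "W = map_quad (\<lambda>z. u * z + (w2 - u * v2)) V"
      unfolding v w map_quad_def prod.case by (simp only: prod.inject)
    then show ?thesis using V W u1
      unfolding congruence_def orientation_preserving_isometry_def by blast
  qed
  have "inj_on moduli_angles (moduli_space a b c d)"
  proof (rule inj_onI)
    fix m n assume mn: "m \<in> moduli_space a b c d" "n \<in> moduli_space a b c d"
      and eq: "moduli_angles m = moduli_angles n"
    obtain V where V: "V \<in> configurations a b c d" "m = congruence a b c d `` {V}"
      using mn(1) unfolding moduli_space_def by (elim quotientE)
    obtain W where W: "W \<in> configurations a b c d" "n = congruence a b c d `` {W}"
      using mn(2) unfolding moduli_space_def by (elim quotientE)
    have "quad_angles V = quad_angles W"
      using eq moduli_angles_class[OF V(1)] moduli_angles_class[OF W(1)] V(2) W(2) by simp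
    then show "m = n" using congr[OF V(1) W(1)] V(2) W(2) equiv_class_eq[OF equiv_congruence] by simp
  qed
  moreover have "moduli_angles ` moduli_space a b c d = level_set a b c d"
  proof (intro equalityI subsetI)
    fix x assume "x \<in> moduli_angles ` moduli_space a b c d"
    then obtain V where V: "V \<in> configurations a b c d" "x = quad_angles V"
      unfolding moduli_space_def using moduli_angles_class by (auto elim!: quotientE)
    obtain v1 v2 v3 v4 where v: "V = (v1, v2, v3, v4)" by (metis prod.exhaust)
    define \<alpha> \<gamma> where "\<alpha> = Arg ((v3 - v2) / (v1 - v2))" and "\<gamma> = Arg ((v1 - v4) / (v3 - v4))"
    have x: "quad_angles (v1, v2, v3, v4) = (cis \<alpha>, cis \<gamma>)"
      by (simp add: quad_angles_def \<alpha>_def \<gamma>_def)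
    note r = quad_angles_relations[OF Q V(1)[unfolded v] x]
    have n: "norm (v1 - v2) = a" "norm (v3 - v4) = c"
      using V(1) by (auto simp: v configurations_def norm_minus_commute)
    have "of_real a * (v1 - v3) = (of_real a - of_real b * cis \<alpha>) * (v1 - v2)"
      using r(1) pos by (simp add: field_simps)
    then have "a * norm (v1 - v3) = norm (of_real a - of_real b * cis \<alpha>) * a"
      using n pos by (metis norm_mult norm_of_real abs_of_pos)
    then have e1: "norm (v1 - v3) = norm (of_real a - of_real b * cis \<alpha>)" using pos by simp
    have "of_real c * (v3 - v1) = (of_real c - of_real d * cis \<gamma>) * (v3 - v4)"
      using r(2) pos by (simp add: field_simps)
    then have "c * norm (v3 - v1) = norm (of_real c - of_real d * cis \<gamma>) * c"
      using n pos by (metis norm_mult norm_of_real abs_of_pos)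
    then have e2: "norm (v1 - v3) = norm (of_real c - of_real d * cis \<gamma>)"
      using pos by (simp add: norm_minus_commute)
    have "level_function a b c d \<alpha> \<gamma> = 0"
      using norm_diff_cis[of a b \<alpha>] norm_diff_cis[of c d \<gamma>] e1 e2
      by (simp add: level_function_def)
    then show "x \<in> level_set a b c d" using V(2) v x by (auto simp: level_set_def)
  next
    fix x assume "x \<in> level_set a b c d"
    then obtain \<alpha> \<gamma> where x: "x = (cis \<alpha>, cis \<gamma>)" and l: "level_function a b c d \<alpha> \<gamma> = 0"
      by (auto simp: level_set_def)
    define e where "e = of_real a - of_real b * cis \<alpha>"
    define k where "k = of_real c - of_real d * cis \<gamma>"
    have "(norm e)\<^sup>2 = (norm k)\<^sup>2"
      using l by (simp add: e_def k_def norm_diff_cis level_function_def)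
    then have ek: "norm e = norm k" by simp
    have "k \<noteq> 0"
    proof
      assume "k = 0"
      then have "e = 0" using ek by simp
      have "of_real a = of_real b * cis \<alpha>" "of_real c = of_real d * cis \<gamma>"
        using \<open>e = 0\<close> \<open>k = 0\<close> by (auto simp: e_def k_def)
      then have "a = b" "c = d"
        using pos by (metis norm_mult norm_of_real norm_cis mult_1_right abs_of_pos)+
      then have "a + (-1) * b + 1 * c + (-1) * d = 0" by simp
      then show False using N unfolding nondegenerate_linkage_def by blast
    qed
    define f where "f = - (of_real c * e / k)"
    have nf: "norm f = c" using ek \<open>k \<noteq> 0\<close> pos by (simp add: f_def norm_mult norm_divide)
    have fk: "f * k = - of_real c * e" using \<open>k \<noteq> 0\<close> by (simp add: f_def)
    define v3 where "v3 = of_real b * cis \<alpha>"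
    define V :: quad where "V = (of_real a, 0, v3, v3 - f)"
    have a4: "of_real a - (v3 - f) = of_real (d / c) * cis \<gamma> * f"
    proof -
      have "of_real c * (of_real a - (v3 - f)) = of_real c * e + of_real c * f"
        by (simp add: v3_def e_def algebra_simps)
      also have "of_real c * e = - (f * k)" using fk by simp
      also have "- (f * k) + of_real c * f = of_real d * cis \<gamma> * f"
        by (simp add: k_def algebra_simps)
      finally show ?thesis using pos by (simp add: field_simps)
    qed
    have V: "V \<in> configurations a b c d"
      using pos nf unfolding V_def configurations_def
      by (simp add: a4 norm_mult norm_divide) (simp add: v3_def norm_mult)
    have "f \<noteq> 0" using nf pos by auto
    have Arg_cis: "cis (Arg (of_real r * cis t)) = cis t" if "r > 0" for r t
    proof -
      have "of_real r * cis t \<noteq> 0" using that by simp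
      then show ?thesis using that
        by (simp add: cis_Arg sgn_mult sgn_of_real)
    qed
    have q1: "(v3 - 0) / (of_real a - 0) = of_real (b / a) * cis \<alpha>" by (simp add: v3_def)
    have q2: "(of_real a - (v3 - f)) / (v3 - (v3 - f)) = of_real (d / c) * cis \<gamma>"
      unfolding a4 using \<open>f \<noteq> 0\<close> by simp
    have "quad_angles V = x"
      unfolding V_def quad_angles_def prod.case q1 q2 x
      using pos by (simp only: Arg_cis divide_pos_pos)
    then have "x = moduli_angles (congruence a b c d `` {V})"
      using moduli_angles_class[OF V] by simp
    then show "x \<in> moduli_angles ` moduli_space a b c d"
      unfolding moduli_space_def using quotientI[OF V] by blast
  qed
  ultimately show ?thesis by (simp add: bij_betw_def)
qed

end

theory Submission
  imports Defs
begin

text \<open>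
  Identify the moduli space with the level curve \<open>p Re u - q Re w = k\<close> in the torus of pairs
  \<open>(u, w) = (cis \<alpha>, cis \<gamma>)\<close>, where \<open>p = 2ab\<close>, \<open>q = 2cd\<close> and \<open>k = a\<^sup>2 + b\<^sup>2 - c\<^sup>2 - d\<^sup>2\<close>; the equation
  says that both cosine laws give the same diagonal. The two quotients in the uniformizer are
  determined by the angles at \<open>v\<^sub>2\<close> and \<open>v\<^sub>4\<close>, and it becomes \<open>r cnj (u w)\<close> with \<open>r = ac/(bd)\<close>
  (\<open>uniformizer_angles\<close>). So everything reduces to the map \<open>(u, w) \<mapsto> u w\<close> on the level curve.

  Its fibre over a unit number \<open>z\<close> is obtained by substituting \<open>w = z cnj u\<close>, which makes the
  equation linear in \<open>u\<close>: it reads \<open>Re (u B) = k\<close> with \<open>B = p - q cnj z\<close>. Thus the fibre is the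
  intersection of a circle of radius \<open>\<bar>B\<bar>\<close> with a vertical line. It has at most two points unless
  \<open>B = 0 = k\<close>, which non-degeneracy excludes, and it is nonempty iff \<open>\<bar>k\<bar> \<le> \<bar>B\<bar>\<close>. As
  \<open>\<bar>B\<bar>\<^sup>2 = p\<^sup>2 + q\<^sup>2 - 2pq Re z\<close>, the image is cut out of the unit circle by a half plane \<open>Re z \<le> t\<close>
  (\<open>product_image\<close>), which is a connected symmetric set. It contains \<open>-1\<close> because \<open>\<bar>k\<bar> < p + q\<close>, and
  is the full circle iff it contains \<open>1\<close>, that is, iff \<open>k\<^sup>2 \<le> (p - q)\<^sup>2\<close>. The difference
  \<open>k\<^sup>2 - (p - q)\<^sup>2\<close> factors into \<open>a + b + c + d > 0\<close> and the three factors of the surjectivity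
  criterion (\<open>linkage_parameters\<close>).

  The derivative of the argument of the uniformizer along the oriented level curve is
  \<open>- (p Im u + q Im w) = - Im (u B)\<close>. The two points of a fibre have conjugate values of \<open>u B\<close>, hence
  opposite signs, and the degree is zero (\<open>circle_line_sgn_sum\<close>, \<open>degree_conjugate_product\<close>). The
  derivative within the curve, an arbitrarily chosen linear map on the ambient space, is pinned
  down on tangent vectors by the chain rule along a differentiable curve inside the level
  curve (\<open>torus_level_derivative_unique\<close>).
\<close>

section \<open>The unit circle and a line\<close>

text \<open>For nonzero \<open>B\<close>, multiplication by \<open>B\<close> identifies this set with the intersection of the circle of radius
  \<open>norm B\<close> with the vertical line \<open>Re x = k\<close>.\<close>

definition circle_line :: "complex \<Rightarrow> real \<Rightarrow> complex set" where
  "circle_line B k = {u. norm u = 1 \<and> Re (u * B) = k}"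

lemma circle_line_nonempty_iff: "circle_line B k \<noteq> {} \<longleftrightarrow> \<bar>k\<bar> \<le> norm B"
proof
  assume "circle_line B k \<noteq> {}"
  then obtain u where "norm u = 1" "Re (u * B) = k" by (auto simp: circle_line_def)
  then show "\<bar>k\<bar> \<le> norm B" using abs_Re_le_cmod[of "u * B"] by (simp add: norm_mult)
next
  assume k: "\<bar>k\<bar> \<le> norm B"
  show "circle_line B k \<noteq> {}"
  proof (cases "B = 0")
    case True
    then have "1 \<in> circle_line B k" using k by (simp add: circle_line_def)
    then show ?thesis by blast
  next
    case False
    define x where "x = Complex k (sqrt ((norm B)\<^sup>2 - k\<^sup>2))"
    have "k\<^sup>2 \<le> (norm B)\<^sup>2" using k by (simp add: abs_le_square_iff[symmetric])
    then have "norm x = norm B" by (simp add: x_def complex_norm)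
    moreover have "x / B * B = x" using False by simp
    ultimately have "x / B \<in> circle_line B k"
      using False by (simp add: circle_line_def norm_divide x_def del: times_complex.sel)
    then show ?thesis by blast
  qed
qed

lemma circle_line_card:
  assumes "B \<noteq> 0"
  shows "finite (circle_line B k)" "card (circle_line B k) \<le> 2"
proof -
  define s where "s = sqrt ((norm B)\<^sup>2 - k\<^sup>2)"
  have sub: "circle_line B k \<subseteq> {Complex k s / B, Complex k (- s) / B}"
  proof
    fix u assume u: "u \<in> circle_line B k"
    then have "norm (u * B) = norm B" "Re (u * B) = k"
      by (auto simp: circle_line_def norm_mult)
    then have "(Im (u * B))\<^sup>2 = (norm B)\<^sup>2 - k\<^sup>2"
      using cmod_power2[of "u * B"] by (simp del: times_complex.sel)
    then have "\<bar>Im (u * B)\<bar> = s" unfolding s_def by (metis real_sqrt_abs)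
    then have "u * B = Complex k s \<or> u * B = Complex k (- s)"
      using \<open>Re (u * B) = k\<close> by (auto simp: complex_eq_iff simp del: times_complex.sel)
    then show "u \<in> {Complex k s / B, Complex k (- s) / B}"
      using assms by (simp add: eq_divide_eq)
  qed
  then show "finite (circle_line B k)" by (rule finite_subset) simp
  have "card (circle_line B k) \<le> card {Complex k s / B, Complex k (- s) / B}"
    using sub by (intro card_mono) auto
  also have "\<dots> \<le> 2" by (simp add: card_insert_if)
  finally show "card (circle_line B k) \<le> 2" .
qed

text \<open>Conjugating \<open>u B\<close>, the reflection of the line in the real axis, is an involution of the set that
  reverses the sign of every term.\<close>

lemma circle_line_sgn_sum:
  assumes "B \<noteq> 0"
  shows "(\<Sum>u\<in>circle_line B k. sgn (Im (u * B))) = 0"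
proof -
  let ?T = "\<lambda>u. cnj (u * B) / B"
  have TB: "?T u * B = cnj (u * B)" for u using assms by simp
  have T: "?T u \<in> circle_line B k" "?T (?T u) = u" "Im (?T u * B) = - Im (u * B)"
    if "u \<in> circle_line B k" for u
  proof -
    have "norm (?T u) = 1"
      using that assms by (simp add: circle_line_def norm_mult norm_divide)
    moreover have "Re (?T u * B) = k"
      unfolding TB complex_cnj using that by (simp add: circle_line_def)
    ultimately show "?T u \<in> circle_line B k" unfolding circle_line_def by blast
    show "?T (?T u) = u" unfolding TB using assms by simp
    show "Im (?T u * B) = - Im (u * B)" unfolding TB by simp
  qed
  have "(\<Sum>u\<in>circle_line B k. sgn (Im (u * B))) = (\<Sum>u\<in>circle_line B k. - sgn (Im (u * B)))"
    by (rule sum.reindex_bij_witness[of _ ?T ?T])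
       (use T in \<open>auto simp: sgn_minus simp del: times_complex.sel\<close>)
  also have "\<dots> = - (\<Sum>u\<in>circle_line B k. sgn (Im (u * B)))" by (rule sum_negf)
  finally show ?thesis by simp
qed

section \<open>The product map on a level curve of the torus\<close>

definition torus_level :: "real \<Rightarrow> real \<Rightarrow> real \<Rightarrow> (complex \<times> complex) set" where
  "torus_level p q k = {(u, w). norm u = 1 \<and> norm w = 1 \<and> p * Re u - q * Re w = k}"

text \<open>The coefficient of \<open>u\<close> after \<open>w = z cnj u\<close> is substituted into \<open>p Re u - q Re w\<close>: since
  \<open>Re (z cnj u) = Re (u cnj z)\<close>, the result is \<open>Re (u (p - q cnj z))\<close>.\<close>

definition fibre_coeff :: "real \<Rightarrow> real \<Rightarrow> complex \<Rightarrow> complex" where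
  "fibre_coeff p q z = of_real p - of_real q * cnj z"

lemma product_fibre:
  assumes "norm z = 1"
  shows "{x \<in> torus_level p q k. fst x * snd x = z}
           = (\<lambda>u. (u, z * cnj u)) ` circle_line (fibre_coeff p q z) k"
proof (intro equalityI subsetI)
  fix x assume "x \<in> {x \<in> torus_level p q k. fst x * snd x = z}"
  then obtain u w where x: "x = (u, w)" "norm u = 1" "norm w = 1"
    "p * Re u - q * Re w = k" "u * w = z"
    by (auto simp: torus_level_def)
  have "u * cnj u = 1" using x(2) by (simp add: complex_norm_square[symmetric])
  then have w: "w = z * cnj u" using x(5) by (metis mult.commute mult.left_commute mult_1)
  have "u \<in> circle_line (fibre_coeff p q z) k"
    using x(2,4) unfolding w circle_line_def fibre_coeff_def by (simp add: algebra_simps)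
  then show "x \<in> (\<lambda>u. (u, z * cnj u)) ` circle_line (fibre_coeff p q z) k"
    using x(1) w by blast
next
  fix x assume "x \<in> (\<lambda>u. (u, z * cnj u)) ` circle_line (fibre_coeff p q z) k"
  then obtain u where x: "x = (u, z * cnj u)" and u: "norm u = 1"
    "Re (u * fibre_coeff p q z) = k"
    by (auto simp: circle_line_def)
  have "u * cnj u = 1" using u(1) by (simp add: complex_norm_square[symmetric])
  then have "u * (z * cnj u) = z" by (metis mult.commute mult.left_commute mult_1)
  moreover have "p * Re u - q * Re (z * cnj u) = k"
    using u(2) by (simp add: fibre_coeff_def algebra_simps)
  ultimately show "x \<in> {x \<in> torus_level p q k. fst x * snd x = z}"
    using assms u(1) by (simp add: x torus_level_def norm_mult del: times_complex.sel)
qed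

lemma norm_fibre_coeff:
  assumes "norm z = 1"
  shows "(norm (fibre_coeff p q z))\<^sup>2 = p\<^sup>2 + q\<^sup>2 - 2 * p * q * Re z"
proof -
  have "(Re z)\<^sup>2 + (Im z)\<^sup>2 = 1" using assms cmod_power2[of z] by simp
  then show ?thesis unfolding cmod_power2 fibre_coeff_def by simp algebra
qed

text \<open>A vanishing coefficient forces \<open>p = q\<close>, and then the equation \<open>Re (u 0) = k\<close> is solvable only
  for \<open>k = 0 = p - q\<close>.\<close>

lemma fibre_coeff_nonzero:
  assumes "p > 0" "q > 0" "\<bar>k\<bar> \<noteq> \<bar>p - q\<bar>" "norm z = 1"
    and "circle_line (fibre_coeff p q z) k \<noteq> {}"
  shows "fibre_coeff p q z \<noteq> 0"
proof
  assume B: "fibre_coeff p q z = 0"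
  then have "k = 0" using assms(5) by (simp add: circle_line_nonempty_iff)
  have "of_real p = of_real q * cnj z" using B by (simp add: fibre_coeff_def)
  then have "p = q" using assms(1,2,4)
    by (metis norm_mult norm_of_real complex_mod_cnj mult_1_right abs_of_pos)
  then show False using assms(3) \<open>k = 0\<close> by simp
qed

lemma product_fibre_card:
  assumes "p > 0" "q > 0" "\<bar>k\<bar> \<noteq> \<bar>p - q\<bar>" "norm z = 1"
  shows "finite {x \<in> torus_level p q k. fst x * snd x = z}"
    and "card {x \<in> torus_level p q k. fst x * snd x = z} \<le> 2"
proof -
  let ?C = "circle_line (fibre_coeff p q z) k"
  have C: "finite ?C" "card ?C \<le> 2"
  proof -
    consider "?C = {}" | "fibre_coeff p q z \<noteq> 0" using fibre_coeff_nonzero[OF assms] by blast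
    then show "finite ?C" "card ?C \<le> 2" by (cases; simp add: circle_line_card)+
  qed
  show "finite {x \<in> torus_level p q k. fst x * snd x = z}"
    unfolding product_fibre[OF assms(4)] using C(1) by simp
  show "card {x \<in> torus_level p q k. fst x * snd x = z} \<le> 2"
    unfolding product_fibre[OF assms(4)] using card_image_le[OF C(1)] C(2) order_trans by blast
qed

text \<open>On the fibre over \<open>z\<close> the summand is the sign of \<open>Im (u B)\<close>, as
  \<open>q Im (z cnj u) = - q Im (u cnj z)\<close>.\<close>

lemma product_fibre_sgn_sum:
  assumes "p > 0" "q > 0" "\<bar>k\<bar> \<noteq> \<bar>p - q\<bar>" "norm z = 1"
  shows "(\<Sum>x | x \<in> torus_level p q k \<and> fst x * snd x = z.
            sgn (p * Im (fst x) + q * Im (snd x))) = 0"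
proof -
  let ?B = "fibre_coeff p q z" and ?i = "\<lambda>u. (u, z * cnj u)"
  have "(\<Sum>x\<in>?i ` circle_line ?B k. sgn (p * Im (fst x) + q * Im (snd x)))
      = (\<Sum>u\<in>circle_line ?B k. sgn (Im (u * ?B)))"
  proof (subst sum.reindex)
    show "inj_on ?i (circle_line ?B k)" by (auto simp: inj_on_def)
    show "sum ((\<lambda>x. sgn (p * Im (fst x) + q * Im (snd x))) \<circ> ?i) (circle_line ?B k)
        = (\<Sum>u\<in>circle_line ?B k. sgn (Im (u * ?B)))"
      by (rule sum.cong) (auto simp: fibre_coeff_def algebra_simps)
  qed
  also have "\<dots> = 0"
    using fibre_coeff_nonzero[OF assms] circle_line_sgn_sum by (cases "circle_line ?B k = {}") auto
  finally show ?thesis by (simp only: product_fibre[OF assms(4)])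
qed

lemma product_image:
  assumes "p > 0" "q > 0"
  shows "(\<lambda>x. fst x * snd x) ` torus_level p q k
           = {z. norm z = 1 \<and> Re z \<le> (p\<^sup>2 + q\<^sup>2 - k\<^sup>2) / (2 * p * q)}"
proof -
  have "z \<in> (\<lambda>x. fst x * snd x) ` torus_level p q k
          \<longleftrightarrow> Re z \<le> (p\<^sup>2 + q\<^sup>2 - k\<^sup>2) / (2 * p * q)" if z: "norm z = 1" for z
  proof -
    have "z \<in> (\<lambda>x. fst x * snd x) ` torus_level p q k
            \<longleftrightarrow> {x \<in> torus_level p q k. fst x * snd x = z} \<noteq> {}" by blast
    also have "\<dots> \<longleftrightarrow> \<bar>k\<bar> \<le> norm (fibre_coeff p q z)"
      unfolding product_fibre[OF z] using circle_line_nonempty_iff by simp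
    also have "\<dots> \<longleftrightarrow> k\<^sup>2 \<le> (norm (fibre_coeff p q z))\<^sup>2"
      using abs_le_square_iff[of k "norm (fibre_coeff p q z)"] by simp
    also have "\<dots> \<longleftrightarrow> Re z \<le> (p\<^sup>2 + q\<^sup>2 - k\<^sup>2) / (2 * p * q)"
      unfolding norm_fibre_coeff[OF z] using assms by (simp add: field_simps)
    finally show ?thesis .
  qed
  moreover have "norm (fst x * snd x) = 1" if "x \<in> torus_level p q k" for x
    using that by (auto simp: torus_level_def norm_mult)
  ultimately show ?thesis by blast
qed

text \<open>The upper and the lower half of the arc are graphs over an interval and share the point
  \<open>-1\<close>.\<close>

lemma connected_circle_halfplane: "connected {z :: complex. norm z = 1 \<and> Re z \<le> t}"
proof (cases "t < - 1")
  case True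
  have "{z :: complex. norm z = 1 \<and> Re z \<le> t} = {}"
  proof -
    have False if "norm z = 1" "Re z \<le> t" for z using that True abs_Re_le_cmod[of z] by linarith
    then show ?thesis by blast
  qed
  then show ?thesis using connected_empty by metis
next
  case False
  define I where "I = {-1..min t 1}"
  define h where "h = (\<lambda>s x. Complex x (s * sqrt (1 - x\<^sup>2)))"
  have conn: "connected (h s ` I)" for s
    unfolding h_def Complex_eq I_def by (intro connected_continuous_image continuous_intros) auto
  have "-1 \<in> h s ` I" for s
    using False by (auto simp: h_def I_def complex_eq_iff intro!: image_eqI[of _ _ "-1"])
  then have "connected (h 1 ` I \<union> h (-1) ` I)" by (intro connected_Un conn) blast
  also have "h 1 ` I \<union> h (-1) ` I = {z :: complex. norm z = 1 \<and> Re z \<le> t}"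
  proof (intro equalityI subsetI)
    fix z assume "z \<in> h 1 ` I \<union> h (-1) ` I"
    then obtain s x where "s\<^sup>2 = 1" "x \<in> I" "z = h s x" by force
    moreover have "x\<^sup>2 \<le> 1" using \<open>x \<in> I\<close> by (auto simp: I_def abs_le_square_iff[of x 1, simplified, symmetric])
    ultimately show "z \<in> {z. norm z = 1 \<and> Re z \<le> t}"
      by (auto simp: h_def I_def cmod_def power_mult_distrib)
  next
    fix z :: complex assume z: "z \<in> {z. norm z = 1 \<and> Re z \<le> t}"
    then have "Re z \<in> I" using abs_Re_le_cmod[of z] by (auto simp: I_def)
    have "(Im z)\<^sup>2 = 1 - (Re z)\<^sup>2" using z cmod_power2[of z] by simp
    then have "\<bar>Im z\<bar> = sqrt (1 - (Re z)\<^sup>2)" by (metis real_sqrt_abs)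
    then have "z = h 1 (Re z) \<or> z = h (-1) (Re z)" by (auto simp: h_def complex_eq_iff)
    then show "z \<in> h 1 ` I \<union> h (-1) ` I" using \<open>Re z \<in> I\<close> by blast
  qed
  finally show ?thesis .
qed

section \<open>Derivatives along a level curve of the torus\<close>

text \<open>The level curve \<open>p cos \<alpha> - q cos \<gamma> = k\<close> in the torus of pairs \<open>(cis \<alpha>, cis \<gamma>)\<close> is oriented by
  the gradient \<open>(- p sin \<alpha>, q sin \<gamma>)\<close> rotated by a right angle. The choice of the rotation
  matches the orientation of linkages, whose level function is \<open>k - p cos \<alpha> + q cos \<gamma>\<close>.\<close>

definition torus_tangent :: "real \<Rightarrow> real \<Rightarrow> complex \<times> complex \<Rightarrow> complex \<times> complex" where
  "torus_tangent p q = (\<lambda>(u, w). ((q * Im w) *\<^sub>R (\<i> * u), (p * Im u) *\<^sub>R (\<i> * w)))"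

text \<open>Derivatives within a thin set are not unique as linear maps on the ambient space. Their
  values on the velocity of a curve inside the set are, because by the chain rule they are the
  derivative of the composition with that curve.\<close>

lemma derivative_unique_along_curve:
  fixes f :: "'a::real_normed_vector \<Rightarrow> 'b::real_normed_vector"
  assumes D: "(f has_derivative D) (at x within M)" "(f has_derivative D') (at x within M)"
    and g: "(g has_vector_derivative v) (at (0::real))" "g 0 = x" "\<forall>\<^sub>F t in nhds 0. g t \<in> M"
  shows "D v = D' v"
proof -
  obtain T where T: "open T" "0 \<in> T" "\<And>t. t \<in> T \<Longrightarrow> g t \<in> M"
    using g(3) by (auto simp: eventually_nhds)
  have "(f \<circ> g has_vector_derivative E v) (at 0)" if "(f has_derivative E) (at x within M)" for E
  proof -
    have "(f has_derivative E) (at (g 0) within g ` T)"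
      using has_derivative_subset[OF that, of "g ` T"] T(3) g(2) by blast
    moreover have "(g has_vector_derivative v) (at 0 within T)"
      using g(1) by (rule has_vector_derivative_at_within)
    ultimately have "(f \<circ> g has_vector_derivative E v) (at 0 within T)"
      using vector_derivative_diff_chain_within by blast
    then show ?thesis using at_within_open[OF T(2,1)] by simp
  qed
  from this[OF D(1)] this[OF D(2)] show ?thesis by (rule vector_derivative_unique_at)
qed

text \<open>Where \<open>Im w \<noteq> 0\<close>, the level curve is locally a graph over its first factor: rotate \<open>u\<close>, solve
  the equation for \<open>Re w\<close>, and take \<open>Im w\<close> as the square root with the sign that it has at the
  given point. The angular speed \<open>q Im w\<close> of \<open>u\<close> is chosen to produce the prescribed tangent
  vector.\<close>

lemma torus_level_curve_graph:
  assumes x: "(u, w) \<in> torus_level p q k" and q: "q \<noteq> 0" and w: "Im w \<noteq> 0"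
  obtains g1 g2 where
    "(g1 has_vector_derivative (q * Im w) *\<^sub>R (\<i> * u)) (at 0)" "g1 0 = u"
    "(g2 has_vector_derivative (p * Im u) *\<^sub>R (\<i> * w)) (at 0)" "g2 0 = w"
    "\<forall>\<^sub>F t in nhds (0::real). (g1 t, g2 t) \<in> torus_level p q k"
proof -
  have uw: "norm u = 1" "norm w = 1" "p * Re u - q * Re w = k"
    using x by (auto simp: torus_level_def)
  define g1 where "g1 = (\<lambda>t::real. u * cis (q * Im w * t))"
  define h where "h = (\<lambda>t. (p * Re (g1 t) - k) / q)"
  define g2 where "g2 = (\<lambda>t. Complex (h t) (sgn (Im w) * sqrt (1 - (h t)\<^sup>2)))"
  have g10: "g1 0 = u" by (simp add: g1_def)
  have dg1: "(g1 has_vector_derivative (q * Im w) *\<^sub>R (\<i> * u)) (at 0)"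
    unfolding g1_def has_vector_derivative_def
    by (auto intro!: derivative_eq_intros simp: scaleR_conv_of_real algebra_simps)
  have h0: "h 0 = Re w" using uw(3) q by (simp add: h_def g10 field_simps)
  have "((\<lambda>t. Re (g1 t)) has_field_derivative - (q * Im w * Im u)) (at 0)"
    using dg1 by (simp add: has_vector_derivative_complex_iff)
  then have "((\<lambda>t. (p * Re (g1 t) - k) / q) has_field_derivative
      (p * - (q * Im w * Im u) - 0) / q) (at 0)"
    by (intro DERIV_cdivide DERIV_diff DERIV_cmult DERIV_const)
  then have dh: "(h has_field_derivative - (p * Im u * Im w)) (at 0)"
    unfolding h_def using q by (simp add: mult_ac)
  have w1: "1 - (Re w)\<^sup>2 = (Im w)\<^sup>2" using uw(2) cmod_power2[of w] by simp
  have pos: "1 - (h 0)\<^sup>2 > 0" using w by (simp add: h0 w1)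
  have "((\<lambda>t. sgn (Im w) * sqrt (1 - (h t)\<^sup>2)) has_field_derivative
      sgn (Im w) * ((- (2 * h 0 * (- (p * Im u * Im w)))) * (inverse (sqrt (1 - (h 0)\<^sup>2)) / 2))) (at 0)"
    using pos by (auto intro!: derivative_eq_intros dh)
  also have "sgn (Im w) * ((- (2 * h 0 * (- (p * Im u * Im w)))) * (inverse (sqrt (1 - (h 0)\<^sup>2)) / 2))
      = p * Im u * Re w"
    unfolding h0 w1 using w by (simp add: sgn_if field_simps)
  finally have dg2: "(g2 has_vector_derivative (p * Im u) *\<^sub>R (\<i> * w)) (at 0)"
    using dh by (simp add: g2_def has_vector_derivative_complex_iff)
  have g20: "g2 0 = w"
    using w by (simp add: g2_def h0 w1 complex_eq_iff sgn_if)
  have "isCont h 0" using dh by (rule DERIV_isCont)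
  then have "((\<lambda>t. 1 - (h t)\<^sup>2) \<longlongrightarrow> 1 - (h 0)\<^sup>2) (nhds 0)"
    by (intro tendsto_intros) (simp add: continuous_at tendsto_nhds_iff)
  then have "\<forall>\<^sub>F t in nhds 0. 1 - (h t)\<^sup>2 > 0" using pos by (rule order_tendstoD)
  then have "\<forall>\<^sub>F t in nhds 0. (g1 t, g2 t) \<in> torus_level p q k"
  proof eventually_elim
    case (elim t)
    have "norm (g1 t) = 1" using uw(1) by (simp add: g1_def norm_mult)
    moreover have "norm (g2 t) = 1"
      using elim w by (simp add: g2_def cmod_def power_mult_distrib sgn_if)
    moreover have "p * Re (g1 t) - q * Re (g2 t) = k" using q by (simp add: g2_def h_def)
    ultimately show ?case by (simp add: torus_level_def)
  qed
  from that[OF dg1 g10 dg2 g20 this] show ?thesis .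
qed

text \<open>Where the tangent vector does not vanish, one of \<open>Im u\<close> and \<open>Im w\<close> is nonzero. Swapping
  the factors replaces \<open>(p, q, k)\<close> by \<open>(q, p, -k)\<close> and preserves the form of the tangent vector, so
  that the local graph exists over one of the two factors.\<close>

lemma torus_level_curve:
  assumes x: "x \<in> torus_level p q k" and pq: "p \<noteq> 0" "q \<noteq> 0" and v: "torus_tangent p q x \<noteq> 0"
  obtains g where "(g has_vector_derivative torus_tangent p q x) (at 0)" "g 0 = x"
    "\<forall>\<^sub>F t in nhds (0::real). g t \<in> torus_level p q k"
proof -
  obtain u w where uw: "x = (u, w)" by fastforce
  consider "Im w \<noteq> 0" | "Im u \<noteq> 0" using v by (auto simp: uw torus_tangent_def zero_prod_def)
  then show ?thesis
  proof cases
    case 1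
    obtain g1 g2 where g: "(g1 has_vector_derivative (q * Im w) *\<^sub>R (\<i> * u)) (at 0)" "g1 0 = u"
      "(g2 has_vector_derivative (p * Im u) *\<^sub>R (\<i> * w)) (at 0)" "g2 0 = w"
      "\<forall>\<^sub>F t in nhds (0::real). (g1 t, g2 t) \<in> torus_level p q k"
      using torus_level_curve_graph[OF x[unfolded uw] pq(2) 1] by blast
    show ?thesis
    proof (rule that[of "\<lambda>t. (g1 t, g2 t)"])
      show "((\<lambda>t. (g1 t, g2 t)) has_vector_derivative torus_tangent p q x) (at 0)"
        using has_derivative_Pair[OF g(1,3)[unfolded has_vector_derivative_def]]
        by (simp add: has_vector_derivative_def uw torus_tangent_def)
    qed (simp_all add: g uw)
  next
    case 2
    have "(w, u) \<in> torus_level q p (- k)" using x by (auto simp: uw torus_level_def)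
    then obtain g1 g2 where g: "(g1 has_vector_derivative (p * Im u) *\<^sub>R (\<i> * w)) (at 0)" "g1 0 = w"
      "(g2 has_vector_derivative (q * Im w) *\<^sub>R (\<i> * u)) (at 0)" "g2 0 = u"
      "\<forall>\<^sub>F t in nhds (0::real). (g1 t, g2 t) \<in> torus_level q p (- k)"
      using torus_level_curve_graph[of w u q p "- k"] pq(1) 2 by blast
    show ?thesis
    proof (rule that[of "\<lambda>t. (g2 t, g1 t)"])
      show "((\<lambda>t. (g2 t, g1 t)) has_vector_derivative torus_tangent p q x) (at 0)"
        using has_derivative_Pair[OF g(3,1)[unfolded has_vector_derivative_def]]
        by (simp add: has_vector_derivative_def uw torus_tangent_def)
      show "\<forall>\<^sub>F t in nhds 0. (g2 t, g1 t) \<in> torus_level p q k"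
        using g(5) by eventually_elim (auto simp: torus_level_def)
    qed (simp_all add: g uw)
  qed
qed

lemma torus_level_derivative_unique:
  assumes "x \<in> torus_level p q k" "p \<noteq> 0" "q \<noteq> 0"
    and D: "(f has_derivative D) (at x within torus_level p q k)"
      "(f has_derivative D') (at x within torus_level p q k)"
  shows "D (torus_tangent p q x) = D' (torus_tangent p q x)"
proof (cases "torus_tangent p q x = 0")
  case True
  then show ?thesis using D[THEN has_derivative_linear] by (simp add: linear_0)
next
  case False
  then obtain g where "(g has_vector_derivative torus_tangent p q x) (at 0)" "g 0 = x"
    "\<forall>\<^sub>F t in nhds (0::real). g t \<in> torus_level p q k"
    using torus_level_curve[OF assms(1-3)] by blast
  then show ?thesis by (rule derivative_unique_along_curve[OF D])
qed

section \<open>The mapping degree\<close>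

lemma scaled_cnj_eq_iff:
  assumes "r \<noteq> 0"
  shows "of_real r * cnj z = y \<longleftrightarrow> z = cnj (y / of_real r)"
proof -
  have "of_real r * cnj z = y \<longleftrightarrow> cnj z = y / of_real r" using assms by (auto simp: field_simps)
  also have "\<dots> \<longleftrightarrow> z = cnj (y / of_real r)" by (metis complex_cnj_cnj)
  finally show ?thesis .
qed

text \<open>Fibre by fibre, the angular derivative is \<open>- Im (u B)\<close>, whose signs cancel. The bound
  \<open>\<bar>k\<bar> < p + q\<close> provides a regular value: over \<open>u w = -1\<close> the coefficient is \<open>B = p + q\<close>, so the
  line \<open>Re x = k\<close> meets the circle of radius \<open>\<bar>B\<bar>\<close> transversally.\<close>

lemma degree_conjugate_product:
  assumes pq: "p > 0" "q > 0" and k: "\<bar>k\<bar> < p + q" "\<bar>k\<bar> \<noteq> \<bar>p - q\<bar>" and r: "r > 0"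
    and f: "\<And>x. x \<in> torus_level p q k \<Longrightarrow> f x = of_real r * cnj (fst x * snd x)"
    and \<tau>: "\<And>x. x \<in> torus_level p q k \<Longrightarrow> \<tau> x = torus_tangent p q x"
  shows "has_mapping_degree (torus_level p q k) \<tau> f r 0"
proof -
  let ?M = "torus_level p q k"
  have deriv: "(f has_derivative (\<lambda>v. of_real r * cnj (fst x * snd v + fst v * snd x))) (at x within ?M)"
    if "x \<in> ?M" for x
    by (rule has_derivative_transform[OF that f])
       (auto intro!: derivative_eq_intros)
  have unit: "norm (fst x) = 1" "norm (snd x) = 1" if "x \<in> ?M" for x
    using that by (auto simp: torus_level_def)
  have ang: "angular_derivative ?M \<tau> f x = - (p * Im (fst x) + q * Im (snd x))" if x: "x \<in> ?M" for x
  proof -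
    obtain u w where uw: "x = (u, w)" by fastforce
    have nz: "cnj (u * w) \<noteq> 0" "u \<noteq> 0" "w \<noteq> 0" using unit[OF x] by (auto simp: uw)
    \<comment> \<open>The Frechet derivative is some derivative within \<open>?M\<close>; on the tangent vector it has to
      agree with the explicit one.\<close>
    have "(f has_derivative frechet_derivative f (at x within ?M)) (at x within ?M)"
      using deriv[OF x] frechet_derivative_works differentiable_def by blast
    from torus_level_derivative_unique[OF x _ _ this deriv[OF x]] pq
    have "frechet_derivative f (at x within ?M) (\<tau> x)
        = of_real r * cnj (u * snd (torus_tangent p q x) + fst (torus_tangent p q x) * w)"
      by (simp add: uw \<tau>[OF x, unfolded uw])
    also have "\<dots> = of_real r * cnj (u * w) * cnj (\<i> * of_real (p * Im u + q * Im w))"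
      by (simp add: uw torus_tangent_def scaleR_conv_of_real algebra_simps)
    finally have "frechet_derivative f (at x within ?M) (\<tau> x) / f x
        = cnj (\<i> * of_real (p * Im u + q * Im w))"
      using f[OF x] nz r by (simp add: uw)
    then show ?thesis by (simp add: angular_derivative_def uw)
  qed
  have fibre: "{x \<in> ?M. f x = y} = {x \<in> ?M. fst x * snd x = cnj (y / of_real r)}" for y
    using f scaled_cnj_eq_iff[of r _ y] r
    by (auto simp del: complex_cnj_mult complex_cnj_divide)
  have unit_z: "norm (cnj (y / of_real r)) = 1" if "y \<in> sphere 0 r" for y
    using that r by (simp add: norm_divide)
  show ?thesis
    unfolding has_mapping_degree_def
  proof (intro conjI ballI impI)
    show "f ` ?M \<subseteq> sphere 0 r"
      using f unit r by (auto simp: norm_mult)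
    show "f differentiable_on ?M"
      using deriv by (auto simp: differentiable_on_def differentiable_def)
    have "continuous_on ?M (\<lambda>x. - (p * Im (fst x) + q * Im (snd x)))"
      by (intro continuous_intros)
    then show "continuous_on ?M (angular_derivative ?M \<tau> f)"
      using ang by (simp cong: continuous_on_cong)
    show "\<exists>y\<in>sphere 0 r. regular_value ?M \<tau> f y"
    proof (intro bexI[of _ "- of_real r"])
      show "regular_value ?M \<tau> f (- of_real r)"
        unfolding regular_value_def
      proof (intro ballI impI notI)
        fix x assume x: "x \<in> ?M" "f x = - of_real r" and "angular_derivative ?M \<tau> f x = 0"
        then have im: "p * Im (fst x) + q * Im (snd x) = 0" using ang by simp
        have "x \<in> {x \<in> ?M. fst x * snd x = -1}" using x r fibre[of "- of_real r"] by auto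
        then obtain u where u: "x = (u, - cnj u)" "norm u = 1" "Re (u * fibre_coeff p q (-1)) = k"
          using product_fibre[of "-1" p q k] by (auto simp: circle_line_def)
        \<comment> \<open>A critical point over \<open>-1\<close> would have \<open>u = 1\<close> or \<open>u = -1\<close>, hence \<open>\<bar>k\<bar> = p + q\<close>.\<close>
        have "(p + q) * Im u = 0" using im u(1) by (simp add: algebra_simps)
        then have "Im u = 0" using pq by simp
        then have "\<bar>Re u\<bar> = 1" using u(2) by (simp add: cmod_eq_Re)
        moreover have "(p + q) * Re u = k" using u(3) by (simp add: fibre_coeff_def algebra_simps)
        ultimately have "\<bar>k\<bar> = p + q" using pq by (metis abs_mult abs_of_pos add_pos_pos mult_1_right)
        then show False using k(1) by simp
      qed
      show "- of_real r \<in> sphere (0 :: complex) r" using r by simp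
    qed
    fix y :: complex assume y: "y \<in> sphere 0 r"
    show "finite {x \<in> ?M. f x = y}"
      unfolding fibre using product_fibre_card(1)[OF pq k(2) unit_z[OF y]] .
    have "(\<Sum>x | x \<in> ?M \<and> f x = y. sgn (angular_derivative ?M \<tau> f x))
        = (\<Sum>x | x \<in> ?M \<and> f x = y. - sgn (p * Im (fst x) + q * Im (snd x)))"
      by (rule sum.cong) (auto simp: ang sgn_minus[symmetric])
    also have "\<dots> = - (\<Sum>x | x \<in> ?M \<and> fst x * snd x = cnj (y / of_real r).
        sgn (p * Im (fst x) + q * Im (snd x)))"
      unfolding fibre by (rule sum_negf)
    also have "\<dots> = of_int 0"
      using product_fibre_sgn_sum[OF pq k(2) unit_z[OF y]] by simp
    finally show "(\<Sum>x | x \<in> ?M \<and> f x = y. sgn (angular_derivative ?M \<tau> f x)) = of_int 0" .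
  qed
qed

section \<open>Linkages\<close>

lemma level_set_torus_level:
  "level_set a b c d = torus_level (2 * a * b) (2 * c * d) (a\<^sup>2 + b\<^sup>2 - c\<^sup>2 - d\<^sup>2)"
proof -
  have F: "level_function a b c d \<alpha> \<gamma> = 0
      \<longleftrightarrow> (cis \<alpha>, cis \<gamma>) \<in> torus_level (2 * a * b) (2 * c * d) (a\<^sup>2 + b\<^sup>2 - c\<^sup>2 - d\<^sup>2)" for \<alpha> \<gamma>
    by (auto simp: level_function_def torus_level_def)
  have cis: "cis (Arg u) = u" if "norm u = 1" for u
    using that rcis_cmod_Arg[of u] by (simp add: rcis_def)
  show ?thesis
  proof (intro equalityI subsetI)
    fix x assume "x \<in> level_set a b c d"
    then show "x \<in> torus_level (2 * a * b) (2 * c * d) (a\<^sup>2 + b\<^sup>2 - c\<^sup>2 - d\<^sup>2)"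
      unfolding level_set_def using F by blast
  next
    fix x assume x: "x \<in> torus_level (2 * a * b) (2 * c * d) (a\<^sup>2 + b\<^sup>2 - c\<^sup>2 - d\<^sup>2)"
    obtain u w where uw: "x = (u, w)" by fastforce
    have "cis (Arg u) = u" "cis (Arg w) = w" using x by (auto simp: uw torus_level_def cis)
    then show "x \<in> level_set a b c d"
      using x F[of "Arg u" "Arg w"] unfolding level_set_def uw by force
  qed
qed

lemma level_tangent_torus_tangent:
  assumes "x \<in> level_set a b c d"
  shows "level_tangent a b c d x = torus_tangent (2 * a * b) (2 * c * d) x"
proof -
  obtain u w where uw: "x = (u, w)" by fastforce
  have n: "norm u = 1" "norm w = 1" using assms by (auto simp: uw level_set_def)
  have s: "sin (Arg z) = Im z" if "norm z = 1" for z
    using that rcis_cmod_Arg[of z] by (metis Im_rcis mult_1)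
  have "deriv (\<lambda>t. level_function a b c d (Arg u) t) (Arg w) = - (2 * c * d * sin (Arg w))"
    unfolding level_function_def by (rule DERIV_imp_deriv) (auto intro!: derivative_eq_intros)
  moreover have "deriv (\<lambda>t. level_function a b c d t (Arg w)) (Arg u) = 2 * a * b * sin (Arg u)"
    unfolding level_function_def by (rule DERIV_imp_deriv) (auto intro!: derivative_eq_intros)
  ultimately show ?thesis by (simp add: uw level_tangent_def torus_tangent_def s n)
qed

text \<open>The quotients \<open>(v\<^sub>2 - v\<^sub>1)/(v\<^sub>2 - v\<^sub>3)\<close> and \<open>(v\<^sub>4 - v\<^sub>1)/(v\<^sub>4 - v\<^sub>3)\<close> are \<open>a/b\<close> times the inverse of
  \<open>cis \<alpha>\<close> and \<open>d/c\<close> times \<open>cis \<gamma>\<close>; for unit numbers inversion is conjugation.\<close>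

lemma uniformizer_angles:
  assumes Q: "quadrilateral_linkage a b c d" and m: "m \<in> moduli_space a b c d"
  shows "uniformizer m
    = of_real (a * c / (b * d)) * cnj (fst (moduli_angles m) * snd (moduli_angles m))"
proof -
  have pos: "a > 0" "b > 0" "c > 0" "d > 0"
    using Q by (auto simp: quadrilateral_linkage_def)
  obtain V where V: "V \<in> configurations a b c d" "m = congruence a b c d `` {V}"
    using m unfolding moduli_space_def by (elim quotientE)
  obtain v1 v2 v3 v4 where v: "V = (v1, v2, v3, v4)" by (metis prod.exhaust)
  obtain u w where uw: "quad_angles V = (u, w)" by fastforce
  have "norm u = 1" "norm w = 1" using uw by (auto simp: v quad_angles_def)
  then have "u * cnj u = 1" "w * cnj w = 1" by (simp_all add: complex_norm_square[symmetric])
  then have inv: "cnj u = inverse u" "cnj w = inverse w" "u \<noteq> 0" "w \<noteq> 0"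
    by (auto dest: inverse_unique)
  note rel = quad_angles_relations[OF Q V(1)[unfolded v] uw[unfolded v]]
  note nz = configuration_sides_nonzero[OF Q V(1)[unfolded v]]
  have "v2 - v3 = of_real (b / a) * u * (v2 - v1)"
    using rel(1) by (metis minus_diff_eq mult_minus_right)
  moreover have "v2 - v1 \<noteq> 0" using nz(1) by simp
  ultimately have R1: "(v2 - v1) / (v2 - v3) = of_real (a / b) * inverse u"
    using pos by (simp add: nonzero_divide_mult_cancel_right divide_inverse mult_ac
        del: right_minus_eq eq_iff_diff_eq_0)
  have R2: "(v4 - v1) / (v4 - v3) = of_real (d / c) * w"
  proof -
    have "v4 - v1 = of_real (d / c) * w * (v4 - v3)"
      using rel(2) by (metis minus_diff_eq mult_minus_right)
    moreover have "v4 - v3 \<noteq> 0" using nz(3) by simp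
    ultimately show ?thesis by (metis nonzero_mult_div_cancel_right)
  qed
  have "quad_uniformizer V = of_real (a * c / (b * d)) * (inverse u * inverse w)"
    unfolding v quad_uniformizer_def prod.case R1 R2 using inv pos by (simp add: field_simps)
  then show ?thesis
    using V uw inv uniformizer_class[OF V(1)] moduli_angles_class[OF V(1)] by simp
qed

text \<open>All three facts come from factorizations: \<open>p + q - k\<close> and \<open>p + q + k\<close> are products of the
  gaps in the quadrilateral inequalities, which non-degeneracy makes strict, and
  \<open>k\<^sup>2 - (p - q)\<^sup>2\<close> is the perimeter times the product in the surjectivity criterion.\<close>

lemma linkage_parameters:
  assumes Q: "quadrilateral_linkage a b c d" and N: "nondegenerate_linkage a b c d"
  defines "p \<equiv> 2 * a * b" and "q \<equiv> 2 * c * d" and "k \<equiv> a\<^sup>2 + b\<^sup>2 - c\<^sup>2 - d\<^sup>2"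
  shows "\<bar>k\<bar> < p + q" "\<bar>k\<bar> \<noteq> \<bar>p - q\<bar>"
    and "\<bar>k\<bar> \<le> \<bar>p - q\<bar> \<longleftrightarrow> (a + b - c - d) * (a - b + c - d) * (a - b - c + d) \<le> 0"
proof -
  have pos: "a > 0" "b > 0" "c > 0" "d > 0"
    and le: "a \<le> b + c + d" "b \<le> a + c + d" "c \<le> a + b + d" "d \<le> a + b + c"
    using Q by (auto simp: quadrilateral_linkage_def)
  have nd: "a + b + c - d \<noteq> 0" "a + b - c + d \<noteq> 0" "a - b + c + d \<noteq> 0" "a - b - c - d \<noteq> 0"
    "a + b - c - d \<noteq> 0" "a - b + c - d \<noteq> 0" "a - b - c + d \<noteq> 0"
    using N by (auto simp: nondegenerate_linkage_def)
  have "(p + q) - k = (c + d + a - b) * (c + d - a + b)"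
    unfolding p_def q_def k_def by algebra
  moreover have "(p + q) + k = (a + b + c - d) * (a + b - c + d)"
    unfolding p_def q_def k_def by algebra
  moreover have "(c + d + a - b) * (c + d - a + b) > 0" "(a + b + c - d) * (a + b - c + d) > 0"
    using le nd by (auto intro!: mult_pos_pos simp: less_le)
  ultimately show "\<bar>k\<bar> < p + q" by linarith
  have f: "k\<^sup>2 - (p - q)\<^sup>2
      = (a + b - c - d) * (a - b + c - d) * (a - b - c + d) * (a + b + c + d)"
    unfolding p_def q_def k_def by algebra
  have s: "a + b + c + d > 0" using pos by simp
  have "k\<^sup>2 \<noteq> (p - q)\<^sup>2" using f nd s by auto
  then show "\<bar>k\<bar> \<noteq> \<bar>p - q\<bar>" by (metis power2_abs)
  show "\<bar>k\<bar> \<le> \<bar>p - q\<bar> \<longleftrightarrow> (a + b - c - d) * (a - b + c - d) * (a - b - c + d) \<le> 0"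
    unfolding abs_le_square_iff
    using f s by (smt (verit) mult_le_0_iff)
qed

theorem theorem3p1:
  fixes a b c d :: real
  assumes "quadrilateral_linkage a b c d"
    and "nondegenerate_linkage a b c d"
  shows "let M = moduli_space a b c d;
             S = {z :: complex. norm z = a * c / (b * d)}
         in uniformizer ` M \<subseteq> S \<and>
            (connected (uniformizer ` M) \<and>
             cnj ` (uniformizer ` M) = uniformizer ` M \<and>
             - complex_of_real (a * c / (b * d)) \<in> uniformizer ` M) \<and>
            (uniformizer ` M = S \<longleftrightarrow>
             (a + b - c - d) * (a - b + c - d) * (a - b - c + d) \<le> 0) \<and>
            (uniformizer_degree a b c d 0 \<and>
             (\<forall>z\<in>S. finite {m \<in> M. uniformizer m = z} \<and>
                   card {m \<in> M. uniformizer m = z} \<le> 2))"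
proof -
  define M where "M = moduli_space a b c d"
  define r where "r = a * c / (b * d)"
  define S where "S = {z :: complex. norm z = r}"
  define p where "p = 2 * a * b"
  define q where "q = 2 * c * d"
  define k where "k = a\<^sup>2 + b\<^sup>2 - c\<^sup>2 - d\<^sup>2"
  define t where "t = (p\<^sup>2 + q\<^sup>2 - k\<^sup>2) / (2 * p * q)"
  have pos: "a > 0" "b > 0" "c > 0" "d > 0"
    using assms(1) by (auto simp: quadrilateral_linkage_def)
  have r: "r > 0" and pq: "p > 0" "q > 0" using pos by (simp_all add: r_def p_def q_def)
  note par = linkage_parameters[OF assms, folded p_def q_def k_def]
  have L: "level_set a b c d = torus_level p q k"
    by (simp add: level_set_torus_level p_def q_def k_def)
  have bij: "bij_betw moduli_angles M (torus_level p q k)"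
    using bij_betw_moduli_angles[OF assms] by (simp add: L M_def)
  have unif: "uniformizer m = of_real r * cnj (fst (moduli_angles m) * snd (moduli_angles m))"
    if "m \<in> M" for m
    using uniformizer_angles[OF assms(1)] that by (simp add: M_def r_def)

  define A where "A = {z :: complex. norm z = 1 \<and> Re z \<le> t}"
  have image: "uniformizer ` M = (\<lambda>z. of_real r * z) ` A"
  proof -
    have "uniformizer ` M = (\<lambda>z. of_real r * cnj z) ` (\<lambda>x. fst x * snd x) ` moduli_angles ` M"
      unfolding image_image using unif by (rule image_cong[OF refl])
    also have "\<dots> = (\<lambda>z. of_real r * z) ` cnj ` A"
      unfolding bij_betw_imp_surj_on[OF bij] product_image[OF pq] by (simp add: image_image A_def t_def)
    also have "cnj ` A = A"
      by (auto simp: A_def intro!: image_eqI[where x = "cnj _"])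
    finally show ?thesis .
  qed
  have image_iff: "y \<in> uniformizer ` M \<longleftrightarrow> norm y = r \<and> Re y \<le> r * t" for y
  proof -
    have "y \<in> uniformizer ` M \<longleftrightarrow> y / of_real r \<in> A"
      unfolding image using r by (auto simp: image_iff intro!: bexI[of _ "y / of_real r"])
    also have "\<dots> \<longleftrightarrow> norm y = r \<and> Re y \<le> r * t"
      using r by (auto simp: A_def norm_divide field_simps)
    finally show ?thesis .
  qed

  \<comment> \<open>The threshold \<open>t\<close> decides which of the points \<open>-r\<close> and \<open>r\<close> lie in the image.\<close>
  have t1: "t > -1"
  proof -
    have "k\<^sup>2 < (p + q)\<^sup>2" using power_strict_mono[OF par(1), of 2] by simp
    then show ?thesis using pq by (simp add: t_def field_simps power2_eq_square)
  qed
  have t2: "1 \<le> t \<longleftrightarrow> \<bar>k\<bar> \<le> \<bar>p - q\<bar>"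
    unfolding abs_le_square_iff t_def using pq by (simp add: field_simps power2_eq_square)

  have sub: "uniformizer ` M \<subseteq> S" using image_iff by (auto simp: S_def)
  have conn: "connected (uniformizer ` M)"
    unfolding image A_def
    by (intro connected_continuous_image connected_circle_halfplane continuous_intros)
  have sym: "cnj ` (uniformizer ` M) = uniformizer ` M"
  proof -
    have "cnj y \<in> uniformizer ` M \<longleftrightarrow> y \<in> uniformizer ` M" for y by (simp add: image_iff)
    then show ?thesis by (auto intro!: image_eqI[where x = "cnj _"])
  qed
  have neg: "- complex_of_real r \<in> uniformizer ` M"
    unfolding image_iff using r t1 mult_strict_left_mono[of "-1" t r] by simp
  have surj: "uniformizer ` M = S \<longleftrightarrow> 1 \<le> t"
  proof
    assume "uniformizer ` M = S"
    then have "of_real r \<in> uniformizer ` M" using r by (simp add: S_def)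
    then show "1 \<le> t" using r by (simp add: image_iff)
  next
    assume "1 \<le> t"
    then have "r \<le> r * t" using r by simp
    then have "y \<in> uniformizer ` M" if "norm y = r" for y
      using that complex_Re_le_cmod[of y] by (simp add: image_iff)
    then show "uniformizer ` M = S" using sub by (auto simp: S_def)
  qed

  have deg: "uniformizer_degree a b c d 0"
    unfolding uniformizer_degree_def L r_def[symmetric] M_def[symmetric]
  proof (rule degree_conjugate_product[OF pq par(1,2) r])
    fix x assume x: "x \<in> torus_level p q k"
    show "(uniformizer \<circ> the_inv_into M moduli_angles) x = of_real r * cnj (fst x * snd x)"
      using unif[of "the_inv_into M moduli_angles x"] x bij
      by (simp add: bij_betwE[OF bij_betw_the_inv_into[OF bij]] f_the_inv_into_f_bij_betw)
    show "level_tangent a b c d x = torus_tangent p q x"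
      using level_tangent_torus_tangent x by (simp add: L p_def q_def)
  qed

  have fibre: "finite {m \<in> M. uniformizer m = y} \<and> card {m \<in> M. uniformizer m = y} \<le> 2"
    if y: "y \<in> S" for y
  proof -
    let ?z = "cnj (y / of_real r)"
    have z: "norm ?z = 1" using y r by (simp add: S_def norm_divide)
    have "uniformizer m = y \<longleftrightarrow> fst (moduli_angles m) * snd (moduli_angles m) = ?z" if "m \<in> M" for m
      unfolding unif[OF that] using scaled_cnj_eq_iff[of r _ y] r by blast
    then have e1: "{m \<in> M. uniformizer m = y}
        = {m \<in> M. fst (moduli_angles m) * snd (moduli_angles m) = ?z}" by blast
    have e2: "moduli_angles ` {m \<in> M. fst (moduli_angles m) * snd (moduli_angles m) = ?z}
        = {x \<in> torus_level p q k. fst x * snd x = ?z}"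
      unfolding bij_betw_imp_surj_on[OF bij, symmetric] by blast
    have bij': "bij_betw moduli_angles {m \<in> M. uniformizer m = y}
        {x \<in> torus_level p q k. fst x * snd x = ?z}"
      unfolding e1 by (rule bij_betw_subset[OF bij Collect_restrict e2])
    show ?thesis
      unfolding bij_betw_finite[OF bij'] bij_betw_same_card[OF bij']
      using product_fibre_card[OF pq par(2) z] by (rule conjI)
  qed
  show ?thesis
    unfolding Let_def M_def[symmetric] r_def[symmetric] S_def[symmetric]
    using sub conn sym neg surj t2 par(3) deg fibre by blast
qed

end
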